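(* Let $G$ be a finite group and let $D\colon G\to\mathrm{GL}(d,\mathbb{R})$ be an absolutely irreducible representation. If $v\in\mathbb{R}^d$ is generic for $D(G)$, then the affine symmetry group of the orbit polytope $P(D(G),v)$ is $\mathrm{AGL}(P(D(G),v))=D(G)$.
   Context: A representation $D\colon G\to\mathrm{GL}(d,\mathbb{R})$ is absolutely irreducible if for every field $K\supseteq\mathbb{R}$ the space $K^d$ has no $D(G)$-invariant subspaces besides $\{0\}$ and $K^d$. For a finite group $H\leq\mathrm{GL}(d,\mathbb{R})$ and $v\in\mathbb{R}^d$, the orbit polytope is $P(H,v)=\operatorname{conv}\{hv\mid h\in H\}$; it is full-dimensional if the affine hull of $\{hv\mid h\in H\}$ is $\mathbb{R}^d$. An affine symmetry of a polytope $P\subset\mathbb{R}^d$ is a bijection of $P$ that is the restriction of an affine map $\mathbb{R}^d\to\mathbb{R}^d$; $\mathrm{AGL}(P)$ is the group of affine symmetries. If $P(H,v)$ is full-dimensional, its barycenter is the origin, so each affine symmetry is the restriction of a unique element of $\mathrm{GL}(d,\mathbb{R})$, and $\mathrm{AGL}(P(H,v))$ is regarded as a subgroup of $\mathrm{GL}(d,\mathbb{R})$. For a field $K$, a finite set $I$ and a family $(v_i)_{i\in I}$ of vectors in $K^d$, put $\mathrm{LinSym}((v_i)_i)=\{\sigma\in\mathrm{Sym}(I)\mid \exists A\in\mathrm{GL}(d,K)\ \forall i\in I:\ Av_i=v_{\sigma(i)}\}$. Let $X=(X_1,\dotsc,X_d)^t$ be a vector of indeterminates, viewed as an element of $K^d$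 with $K=\mathbb{R}(X_1,\dotsc,X_d)$. For a finite group $H\leq\mathrm{GL}(d,\mathbb{R})$ having at least one full-dimensional orbit polytope, a point $v\in\mathbb{R}^d$ is called generic for $H$ if $P(H,v)$ is full-dimensional, $v$ has trivial stabilizer in $H$, and $\mathrm{LinSym}((hX)_{h\in H})=\mathrm{LinSym}((hv)_{h\in H})$ (the first computed over $K=\mathbb{R}(X_1,\dotsc,X_d)$, the second over $\mathbb{R}$). *)

theory Defs
  imports
    "HOL-Analysis.Analysis"
    "HOL-Algebra.Generated_Fields"
    "HOL-Algebra.Module"
    "HOL-Algebra.UnivPoly"
    "HOL-Algebra.Weak_Morphisms"
    "HOL-Combinatorics.Permutations"
    "HOL-Computational_Algebra.Fraction_Field"
    "HOL-Library.Poly_Mapping"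
begin

definition GL :: "(real^'n^'n) monoid" where
  "GL = \<lparr>carrier = {A. invertible A}, mult = (**), one = mat 1\<rparr>"


section \<open>Absolutely irreducible representations\<close>

text \<open>
  The fields in this section are rings of HOL-Algebra, because the field is bound
  by a quantifier inside the definition of absolute irreducibility. The vector space \<open>K\<^sup>d\<close>
  consists of the vectors of type \<open>'k^'n\<close> all of whose entries lie in the carrier of \<open>K\<close>;
  the multiplicative part of the record plays no role.
\<close>

definition real_ring :: "real ring" where
  "real_ring = \<lparr>carrier = UNIV, mult = (*), one = 1, zero = 0, add = (+)\<rparr>"

definition vec_space :: "'k ring \<Rightarrow> ('k, 'k^'n) module" where
  "vec_space K =
    \<lparr>carrier = {w. \<forall>i. w $ i \<in> carrier K},
     mult = undefined, one = undefined,
     zero = (\<chi> i. \<zero>\<^bsub>K\<^esub>),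
     add = (\<lambda>u w. \<chi> i. u $ i \<oplus>\<^bsub>K\<^esub> w $ i),
     smult = (\<lambda>c w. \<chi> i. c \<otimes>\<^bsub>K\<^esub> w $ i)\<rparr>"

text \<open>A real matrix acting on \<open>K\<^sup>d\<close> through an embedding \<open>\<phi>\<close> of the reals into \<open>K\<close>:\<close>

definition mat_act :: "'k ring \<Rightarrow> (real \<Rightarrow> 'k) \<Rightarrow> real^'n^'n \<Rightarrow> 'k^'n \<Rightarrow> 'k^'n" where
  "mat_act K \<phi> A w = (\<chi> i. \<Oplus>\<^bsub>K\<^esub>j\<in>UNIV. \<phi> (A $ i $ j) \<otimes>\<^bsub>K\<^esub> w $ j)"

definition irreducible_over ::
  "'k ring \<Rightarrow> (real \<Rightarrow> 'k) \<Rightarrow> ('a, 'b) monoid_scheme \<Rightarrow> ('a \<Rightarrow> real^'n^'n) \<Rightarrow> bool" where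
  "irreducible_over K \<phi> G D \<longleftrightarrow>
    (\<forall>U. submodule U K (vec_space K) \<and> (\<forall>g\<in>carrier G. \<forall>w\<in>U. mat_act K \<phi> (D g) w \<in> U)
      \<longrightarrow> U = {\<zero>\<^bsub>vec_space K\<^esub>} \<or> U = carrier (vec_space K))"

text \<open>
  HOL cannot quantify over all types inside a definition, so \<open>K\<close> ranges over all fields whose
  carrier is some subset of the type \<^typ>\<open>complex\<close>, with arbitrary operations: up to isomorphism,
  all extension fields of the reals of cardinality at most the continuum. This is no restriction:
  \<open>absolutely_irreducible_imp_irreducible_over\<close> below derives irreducibility over every
  extension field of the reals, on a carrier in an arbitrary type.
\<close>

definition absolutely_irreducible ::
  "('a, 'b) monoid_scheme \<Rightarrow> ('a \<Rightarrow> real^'n^'n) \<Rightarrow> bool" where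
  "absolutely_irreducible G D \<longleftrightarrow>
    (\<forall>(K :: complex ring) \<phi>. field K \<and> \<phi> \<in> ring_hom real_ring K
      \<longrightarrow> irreducible_over K \<phi> G D)"

lemma vec_space_sel:
  "carrier (vec_space K) = {w. \<forall>i. w $ i \<in> carrier K}"
  "\<zero>\<^bsub>vec_space K\<^esub> = (\<chi> i. \<zero>\<^bsub>K\<^esub>)"
  "u \<oplus>\<^bsub>vec_space K\<^esub> w = (\<chi> i. u $ i \<oplus>\<^bsub>K\<^esub> w $ i)"
  "c \<odot>\<^bsub>vec_space K\<^esub> w = (\<chi> i. c \<otimes>\<^bsub>K\<^esub> w $ i)"
  by (simp_all add: vec_space_def)

lemma module_vec_space:
  assumes "cring K"
  shows "module K (vec_space K :: ('k, 'k^'n) module)"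
proof -
  interpret cring K by fact
  have "abelian_group (vec_space K :: ('k, 'k^'n) module)"
  proof (rule abelian_groupI)
    fix x :: "'k^'n" assume "x \<in> carrier (vec_space K)"
    then show "\<exists>y\<in>carrier (vec_space K). y \<oplus>\<^bsub>vec_space K\<^esub> x = \<zero>\<^bsub>vec_space K\<^esub>"
      by (intro bexI[of _ "\<chi> i. \<ominus>\<^bsub>K\<^esub> x $ i"]) (auto simp: vec_space_sel vec_eq_iff l_neg)
  qed (auto simp: vec_space_sel vec_eq_iff a_ac)
  then show ?thesis
    by (intro moduleI)
      (auto simp: vec_space_sel vec_eq_iff l_distr r_distr m_assoc intro: is_cring)
qed

lemma submodule_vec_spaceD:
  assumes "cring K" "submodule U K (vec_space K :: ('k, 'k^'n) module)"
  shows "U \<subseteq> carrier (vec_space K)" "\<zero>\<^bsub>vec_space K\<^esub> \<in> U"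
    "\<And>u w. u \<in> U \<Longrightarrow> w \<in> U \<Longrightarrow> u \<oplus>\<^bsub>vec_space K\<^esub> w \<in> U"
    "\<And>c u. c \<in> carrier K \<Longrightarrow> u \<in> U \<Longrightarrow> c \<odot>\<^bsub>vec_space K\<^esub> u \<in> U"
  using subgroup.subset[OF submodule.axioms(1)[OF assms(2)]]
    subgroup.one_closed[OF submodule.axioms(1)[OF assms(2)]]
    subgroup.m_closed[OF submodule.axioms(1)[OF assms(2)]]
    submodule.smult_closed[OF assms(2)]
  by auto

lemma submodule_vec_space_eq_carrier:
  assumes K: "cring K" and U: "submodule U K (vec_space K :: ('k, 'k^'n) module)"
    and unit: "\<And>i. (\<chi> j. if j = i then \<one>\<^bsub>K\<^esub> else \<zero>\<^bsub>K\<^esub>) \<in> U"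
  shows "U = carrier (vec_space K)"
proof
  note UD = submodule_vec_spaceD[OF K U]
  interpret cring K by fact
  show "U \<subseteq> carrier (vec_space K)" by (rule UD(1))
  have partial: "(\<chi> j. if j \<in> S then x $ j else \<zero>\<^bsub>K\<^esub>) \<in> U"
    if "finite S" and x: "x \<in> carrier (vec_space K)" for S and x :: "'k^'n"
    using \<open>finite S\<close>
  proof (induction S)
    case empty
    then show ?case using UD(2) by (simp add: vec_space_sel)
  next
    case (insert i S)
    have "x $ i \<odot>\<^bsub>vec_space K\<^esub> (\<chi> j. if j = i then \<one>\<^bsub>K\<^esub> else \<zero>\<^bsub>K\<^esub>) \<in> U"
      using UD(4)[OF _ unit] x by (simp add: vec_space_sel)
    from UD(3)[OF this insert.IH]
    have "(x $ i \<odot>\<^bsub>vec_space K\<^esub> (\<chi> j. if j = i then \<one>\<^bsub>K\<^esub> else \<zero>\<^bsub>K\<^esub>)) \<oplus>\<^bsub>vec_space K\<^esub>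
        (\<chi> j. if j \<in> S then x $ j else \<zero>\<^bsub>K\<^esub>) \<in> U" .
    also have "(x $ i \<odot>\<^bsub>vec_space K\<^esub> (\<chi> j. if j = i then \<one>\<^bsub>K\<^esub> else \<zero>\<^bsub>K\<^esub>)) \<oplus>\<^bsub>vec_space K\<^esub>
        (\<chi> j. if j \<in> S then x $ j else \<zero>\<^bsub>K\<^esub>) = (\<chi> j. if j \<in> insert i S then x $ j else \<zero>\<^bsub>K\<^esub>)"
      using x insert.hyps by (auto simp: vec_space_sel vec_eq_iff)
    finally show ?case .
  qed
  show "carrier (vec_space K) \<subseteq> U"
  proof
    fix x :: "'k^'n" assume "x \<in> carrier (vec_space K)"
    from partial[OF _ this, of UNIV] show "x \<in> U" by simp
  qed
qed

lemma generate_field_continuum: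
  fixes K :: "'k ring"
  assumes H: "(card_of (H :: 'k set), card_of (UNIV :: real set)) \<in> ordLeq"
  shows "\<exists>f :: 'k \<Rightarrow> complex. inj_on f (generate_field K H)"
proof -
  define B where "B = (UNIV :: real set)"
  define step where "step S = S \<union> (\<lambda>x. \<ominus>\<^bsub>K\<^esub> x) ` S \<union> (\<lambda>x. inv\<^bsub>K\<^esub> x) ` S
    \<union> (\<lambda>(x, y). x \<oplus>\<^bsub>K\<^esub> y) ` (S \<times> S) \<union> (\<lambda>(x, y). x \<otimes>\<^bsub>K\<^esub> y) ` (S \<times> S)" for S
  define L where "L n = (step ^^ n) (insert \<one>\<^bsub>K\<^esub> H)" for n
  have inf: "infinite B" by (simp add: B_def infinite_UNIV_char_0)
  have img: "(card_of (h ` S), card_of B) \<in> ordLeq" if "(card_of S, card_of B) \<in> ordLeq"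
    for h :: "'c \<Rightarrow> 'd" and S
    using card_of_image that by (rule ordLeq_transitive)
  note Un = card_of_Un_ordLeq_infinite_Field[where r = "card_of B", simplified Field_card_of,
      OF inf _ _ card_of_card_order_on]
  note Times = card_of_Times_ordLeq_infinite_Field[where r = "card_of B",
      simplified Field_card_of, OF inf _ _ card_of_card_order_on]
  have step: "(card_of (step S), card_of B) \<in> ordLeq" if "(card_of S, card_of B) \<in> ordLeq" for S
    unfolding step_def
    by (intro Un img Times that)
  have sing: "(card_of {\<one>\<^bsub>K\<^esub>}, card_of B) \<in> ordLeq"
    by (intro card_of_singl_ordLeq) (simp add: B_def)
  have "(card_of (L n), card_of B) \<in> ordLeq" for n
  proof (induction n)
    case 0
    have "insert \<one>\<^bsub>K\<^esub> H = {\<one>\<^bsub>K\<^esub>} \<union> H" by simp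
    then show ?case using Un[OF sing H[folded B_def]] by (simp add: L_def)
  next
    case (Suc n)
    then show ?case using step by (simp add: L_def)
  qed
  then have card: "(card_of (\<Union>n. L n), card_of B) \<in> ordLeq"
    using inf infinite_iff_card_of_nat[of B] by (intro card_of_UNION_ordLeq_infinite) auto
  have mono: "L m \<subseteq> L n" if "m \<le> n" for m n
    using lift_Suc_mono_le[of L, OF _ that] by (auto simp: L_def step_def)
  have both: "\<exists>n. x \<in> L n \<and> y \<in> L n" if "x \<in> L a" "y \<in> L b" for x y a b
    using mono[of a "max a b"] mono[of b "max a b"] that by (intro exI[of _ "max a b"]) auto
  have "x \<in> (\<Union>n. L n)" if "x \<in> generate_field K H" for x
    using that
  proof induction
    case one
    then show ?case by (auto simp: L_def intro!: exI[of _ 0])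
  next
    case (incl h)
    then show ?case by (auto simp: L_def intro!: exI[of _ 0])
  next
    case (a_inv h)
    then obtain n where "h \<in> L n" by blast
    then have "\<ominus>\<^bsub>K\<^esub> h \<in> L (Suc n)" by (auto simp: L_def step_def)
    then show ?case by blast
  next
    case (m_inv h)
    then obtain n where "h \<in> L n" by blast
    then have "inv\<^bsub>K\<^esub> h \<in> L (Suc n)" by (auto simp: L_def step_def)
    then show ?case by blast
  next
    case (eng_add h1 h2)
    then obtain n where "h1 \<in> L n" "h2 \<in> L n" using both by blast
    then have "h1 \<oplus>\<^bsub>K\<^esub> h2 \<in> L (Suc n)" by (auto simp: L_def step_def)
    then show ?case by blast
  next
    case (eng_mult h1 h2)
    then obtain n where "h1 \<in> L n" "h2 \<in> L n" using both by blast
    then have "h1 \<otimes>\<^bsub>K\<^esub> h2 \<in> L (Suc n)" by (auto simp: L_def step_def)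
    then show ?case by blast
  qed
  then have sub: "generate_field K H \<subseteq> (\<Union>n. L n)" by blast
  from card have "\<exists>f. inj_on f (\<Union>n. L n) \<and> f ` (\<Union>n. L n) \<subseteq> B"
    by (subst card_of_ordLeq)
  then obtain f :: "'k \<Rightarrow> real" where f: "inj_on f (\<Union>n. L n)" by blast
  then have "inj_on f (generate_field K H)"
    by (rule inj_on_subset[OF _ sub])
  then have "inj_on (\<lambda>x. complex_of_real (f x)) (generate_field K H)"
    unfolding inj_on_def of_real_eq_iff .
  then show ?thesis by (rule exI[where x = "\<lambda>x. complex_of_real (f x)"])
qed

theorem absolutely_irreducible_imp_irreducible_over:
  fixes K :: "'k ring" and D :: "'a \<Rightarrow> real^'n^'n"
  assumes irr: "absolutely_irreducible G D"
    and "field K" and \<phi>: "\<phi> \<in> ring_hom real_ring K"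
  shows "irreducible_over K \<phi> G D"
  unfolding irreducible_over_def
proof (intro allI impI, elim conjE)
  fix U :: "('k^'n) set"
  assume U: "submodule U K (vec_space K)"
    and inv: "\<forall>g\<in>carrier G. \<forall>w\<in>U. mat_act K \<phi> (D g) w \<in> U"
  interpret K: field K by fact
  note UD = submodule_vec_spaceD[OF K.is_cring U]
  have \<phi>_carr: "\<phi> r \<in> carrier K" for r
    using ring_hom_closed[OF \<phi>] by (simp add: real_ring_def)
  show "U = {\<zero>\<^bsub>vec_space K\<^esub>} \<or> U = carrier (vec_space K)"
  proof (cases "U = {\<zero>\<^bsub>vec_space K\<^esub>}")
    case False
    then obtain w where w: "w \<in> U" "w \<noteq> \<zero>\<^bsub>vec_space K\<^esub>"
      using UD(2) by blast
    define H where "H = range \<phi> \<union> range (\<lambda>i. w $ i)"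
    define L where "L = generate_field K H"
    define KL where "KL = carrier_update (\<lambda>_. L) K"
    have H: "H \<subseteq> carrier K"
      using \<phi>_carr UD(1) w(1) by (auto simp: H_def vec_space_sel)
    have LK: "L \<subseteq> carrier K"
      using K.generate_field_incl[OF H] by (simp add: L_def)
    have HL: "H \<subseteq> L"
      by (auto simp: L_def intro: generate_field.incl)
    have fKL: "field KL"
      using K.generate_field_is_field[OF H] by (simp add: KL_def L_def)
    interpret KL: field KL by fact
    have inf: "infinite (UNIV :: real set)" by (simp add: infinite_UNIV_char_0)
    have "(card_of H, card_of (UNIV :: real set)) \<in> ordLeq"
      unfolding H_def
      by (intro card_of_Un_ordLeq_infinite_Field[where r = "card_of (UNIV :: real set)",
            simplified Field_card_of, OF inf _ _ card_of_card_order_on] card_of_image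
          ordLess_imp_ordLeq[OF finite_ordLess_infinite[OF card_of_Well_order card_of_Well_order]])
        (use inf in \<open>simp_all add: Field_card_of\<close>)
    then obtain f :: "'k \<Rightarrow> complex" where f: "inj_on f L"
      using generate_field_continuum unfolding L_def by blast
    define C where "C = image_ring f KL"
    have injf: "inj_on f (carrier KL)" using f by (simp add: KL_def)
    have fC: "field C"
      unfolding C_def by (rule KL.inj_imp_image_ring_is_field[OF injf])
    interpret C: field C by fact
    have iso: "f \<in> ring_iso KL C"
      unfolding C_def by (rule inj_imp_image_ring_iso[OF injf])
    define h where "h = inv_into (carrier KL) f"
    have "h \<in> ring_iso C KL"
      unfolding h_def by (rule ring_iso_set_sym[OF KL.ring_axioms iso])
    then have homh: "h \<in> ring_hom C K"
      using LK by (auto simp: ring_iso_def ring_hom_def KL_def)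
    have hf: "h (f x) = x" if "x \<in> L" for x
      using that f by (simp add: h_def KL_def)
    have fcarr: "f x \<in> carrier C" if "x \<in> L" for x
      using that by (simp add: C_def image_ring_carrier KL_def)
    interpret h: ring_hom_cring C K h
      by (intro UnivPoly.ring_hom_cringI homh C.is_cring K.is_cring)
    define \<psi> where "\<psi> = f \<circ> \<phi>"
    have \<phi>L: "\<phi> r \<in> L" for r using HL by (auto simp: H_def)
    have "\<phi> \<in> ring_hom real_ring KL"
      using \<phi> \<phi>L by (auto simp: ring_hom_def KL_def)
    then have \<psi>: "\<psi> \<in> ring_hom real_ring C"
      unfolding \<psi>_def using iso by (auto simp: ring_iso_def intro: ring_hom_trans)
    have h\<psi>: "h (\<psi> r) = \<phi> r" for r
      using hf[OF \<phi>L] by (simp add: \<psi>_def)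
    have \<psi>_carr: "\<psi> r \<in> carrier C" for r
      using fcarr[OF \<phi>L] by (simp add: \<psi>_def)
    define hv where "hv u = (\<chi> i. h (u $ i))" for u :: "complex^'n"
    have hv_add: "hv (u \<oplus>\<^bsub>vec_space C\<^esub> u') = hv u \<oplus>\<^bsub>vec_space K\<^esub> hv u'"
      if "u \<in> carrier (vec_space C)" "u' \<in> carrier (vec_space C)" for u u'
      using that by (simp add: hv_def vec_space_sel)
    have hv_smult: "hv (c \<odot>\<^bsub>vec_space C\<^esub> u) = h c \<odot>\<^bsub>vec_space K\<^esub> hv u"
      if "c \<in> carrier C" "u \<in> carrier (vec_space C)" for c u
      using that by (simp add: hv_def vec_space_sel)
    have hv_act: "hv (mat_act C \<psi> A u) = mat_act K \<phi> A (hv u)"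
      if "u \<in> carrier (vec_space C)" for A u
    proof -
      have "h (\<Oplus>\<^bsub>C\<^esub>j\<in>UNIV. \<psi> (A $ i $ j) \<otimes>\<^bsub>C\<^esub> u $ j)
          = (\<Oplus>\<^bsub>K\<^esub>j\<in>UNIV. \<phi> (A $ i $ j) \<otimes>\<^bsub>K\<^esub> h (u $ j))" for i
      proof (subst h.hom_finsum)
        show "(\<lambda>j. \<psi> (A $ i $ j) \<otimes>\<^bsub>C\<^esub> u $ j) \<in> UNIV \<rightarrow> carrier C"
          using that \<psi>_carr by (auto simp: vec_space_sel)
        show "(\<Oplus>\<^bsub>K\<^esub>j\<in>UNIV. (h \<circ> (\<lambda>j. \<psi> (A $ i $ j) \<otimes>\<^bsub>C\<^esub> u $ j)) j)
          = (\<Oplus>\<^bsub>K\<^esub>j\<in>UNIV. \<phi> (A $ i $ j) \<otimes>\<^bsub>K\<^esub> h (u $ j))"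
          using that \<psi>_carr \<phi>_carr
          by (intro K.finsum_cong') (auto simp: vec_space_sel h\<psi>)
      qed
      then show ?thesis by (simp add: hv_def mat_act_def)
    qed
    define U' where "U' = {u \<in> carrier (vec_space C). hv u \<in> U}"
    interpret MC: module C "vec_space C :: (complex, complex^'n) module"
      by (rule module_vec_space[OF C.is_cring])
    have neg: "\<ominus>\<^bsub>vec_space C\<^esub> u = (\<ominus>\<^bsub>C\<^esub> \<one>\<^bsub>C\<^esub>) \<odot>\<^bsub>vec_space C\<^esub> u"
      if "u \<in> carrier (vec_space C)" for u :: "complex^'n"
      using that MC.smult_l_minus[of "\<one>\<^bsub>C\<^esub>" u] by simp
    have smult_U': "c \<odot>\<^bsub>vec_space C\<^esub> u \<in> U'" if "c \<in> carrier C" "u \<in> U'" for c u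
      using that UD(4) by (auto simp: U'_def hv_smult)
    have subU': "submodule U' C (vec_space C)"
    proof (rule MC.submoduleI)
      show "U' \<subseteq> carrier (vec_space C)" by (auto simp: U'_def)
      show "\<zero>\<^bsub>vec_space C\<^esub> \<in> U'"
        using UD(2) by (auto simp: U'_def hv_def vec_space_sel)
      show "\<ominus>\<^bsub>vec_space C\<^esub> a \<in> U'" if "a \<in> U'" for a
        using smult_U'[OF _ that, of "\<ominus>\<^bsub>C\<^esub> \<one>\<^bsub>C\<^esub>"] that neg by (auto simp: U'_def)
      show "a \<oplus>\<^bsub>vec_space C\<^esub> b \<in> U'" if "a \<in> U'" "b \<in> U'" for a b
        using that UD(3) by (auto simp: U'_def hv_add)
      show "c \<odot>\<^bsub>vec_space C\<^esub> u \<in> U'" if "c \<in> carrier C" "u \<in> U'" for c u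
        using that by (rule smult_U')
    qed
    have "mat_act C \<psi> (D g) u \<in> U'" if "g \<in> carrier G" "u \<in> U'" for g u
    proof -
      have "mat_act C \<psi> (D g) u \<in> carrier (vec_space C)"
        using that \<psi>_carr
        by (auto simp: U'_def mat_act_def vec_space_sel intro!: C.finsum_closed)
      then show ?thesis using that inv by (auto simp: U'_def hv_act)
    qed
    with subU' have "U' = {\<zero>\<^bsub>vec_space C\<^esub>} \<or> U' = carrier (vec_space C)"
      using irr fC \<psi> unfolding absolutely_irreducible_def irreducible_over_def by blast
    moreover have "U' \<noteq> {\<zero>\<^bsub>vec_space C\<^esub>}"
    proof
      assume 0: "U' = {\<zero>\<^bsub>vec_space C\<^esub>}"
      have wL: "w $ i \<in> L" for i using HL by (auto simp: H_def)
      have "hv (\<chi> i. f (w $ i)) = w" by (simp add: hv_def hf wL vec_eq_iff)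
      then have "(\<chi> i. f (w $ i)) \<in> U'"
        using w(1) fcarr wL by (auto simp: U'_def vec_space_sel)
      with 0 have "hv (\<chi> i. f (w $ i)) = hv (\<zero>\<^bsub>vec_space C\<^esub>)" by simp
      then show False
        using w(2) \<open>hv (\<chi> i. f (w $ i)) = w\<close> by (simp add: hv_def vec_space_sel)
    qed
    ultimately have full: "U' = carrier (vec_space C)" by blast
    have "U = carrier (vec_space K)"
    proof (rule submodule_vec_space_eq_carrier[OF K.is_cring U])
      fix i :: 'n
      define e :: "complex^'n" where "e = (\<chi> j. if j = i then \<one>\<^bsub>C\<^esub> else \<zero>\<^bsub>C\<^esub>)"
      have "e \<in> U'" unfolding full by (auto simp: e_def vec_space_sel)
      moreover have "hv e = (\<chi> j. if j = i then \<one>\<^bsub>K\<^esub> else \<zero>\<^bsub>K\<^esub>)"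
        by (auto simp: hv_def e_def vec_eq_iff)
      ultimately show "(\<chi> j. if j = i then \<one>\<^bsub>K\<^esub> else \<zero>\<^bsub>K\<^esub>) \<in> U"
        by (simp add: U'_def)
    qed
    then show ?thesis ..
  qed simp
qed


section \<open>Orbit polytopes and their affine symmetries\<close>

definition orbit_polytope :: "(real^'n^'n) set \<Rightarrow> real^'n \<Rightarrow> (real^'n) set" where
  "orbit_polytope H v = convex hull ((\<lambda>h. h *v v) ` H)"

definition full_dimensional_orbit :: "(real^'n^'n) set \<Rightarrow> real^'n \<Rightarrow> bool" where
  "full_dimensional_orbit H v \<longleftrightarrow> affine hull ((\<lambda>h. h *v v) ` H) = UNIV"

definition affine_symmetries :: "(real^'n) set \<Rightarrow> (real^'n \<Rightarrow> real^'n) set" where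
  "affine_symmetries P =
    {s \<in> extensional P. bij_betw s P P \<and> (\<exists>f c. linear f \<and> (\<forall>x\<in>P. s x = f x + c))}"

text \<open>
  \<open>AGL P\<close> is only meaningful when every affine symmetry of \<open>P\<close> is the restriction of
  a unique invertible matrix, as is the case for full-dimensional orbit polytopes.
\<close>

definition AGL :: "(real^'n) set \<Rightarrow> (real^'n^'n) set" where
  "AGL P = (\<lambda>s. THE A. invertible A \<and> (\<forall>x\<in>P. s x = A *v x)) ` affine_symmetries P"


section \<open>Generic points\<close>

definition LinSym :: "'i set \<Rightarrow> ('i \<Rightarrow> 'k::field^'n) \<Rightarrow> ('i \<Rightarrow> 'i) set" where
  "LinSym I v = {\<sigma>. \<sigma> permutes I \<and>
    (\<exists>A :: 'k^'n^'n. invertible A \<and> (\<forall>i\<in>I. A *v v i = v (\<sigma> i)))}"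

text \<open>
  The rational function field over the reals with indeterminates indexed by \<open>'n\<close> is the field of
  fractions of the polynomial ring \<open>('n \<Rightarrow>\<^sub>0 nat) \<Rightarrow>\<^sub>0 real\<close> (finitely supported maps from
  exponent vectors to coefficients). The linear order on \<open>'n\<close> is only there because the library
  needs it to make this ring an integral domain.
\<close>

definition rat_const :: "real \<Rightarrow> (('n::linorder \<Rightarrow>\<^sub>0 nat) \<Rightarrow>\<^sub>0 real) fract" where
  "rat_const c = Fract (Poly_Mapping.single 0 c) 1"

definition rat_X :: "(('n::{finite,linorder} \<Rightarrow>\<^sub>0 nat) \<Rightarrow>\<^sub>0 real) fract ^ 'n::{finite,linorder}" where
  "rat_X = (\<chi> i. Fract (Poly_Mapping.single (Poly_Mapping.single i 1) 1) 1)"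

definition generic_point ::
  "(real^'n::{finite,linorder}^'n::{finite,linorder}) set \<Rightarrow> real^'n::{finite,linorder} \<Rightarrow> bool" where
  "generic_point H v \<longleftrightarrow>
    full_dimensional_orbit H v \<and>
    (\<forall>h\<in>H. h *v v = v \<longrightarrow> h = mat 1) \<and>
    LinSym H (\<lambda>h. map_matrix rat_const h *v rat_X)
      = LinSym H (\<lambda>h. h *v v)"

end

theory Submission
  imports Defs "HOL-Computational_Algebra.Fundamental_Theorem_Algebra"
begin

text \<open>
  An affine symmetry of the orbit polytope permutes the vertices \<open>hv\<close>, hence fixes their barycentre
  \<open>0\<close> and is given by a matrix \<open>A\<close> with \<open>A(hv) = \<sigma>(h)v\<close>. Since \<open>v\<close> is generic, a matrix \<open>B\<close> over
  \<open>\<real>(X)\<close> satisfies \<open>B(hX) = \<sigma>(h)X\<close>. Letting \<open>\<sigma>\<close> vary, the matrices \<open>A\<close> and \<open>B\<close> give two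
  representations of a finite group containing \<open>G\<close> that agree on \<open>G\<close>. An averaged intertwiner
  between them commutes with \<open>D(G)\<close>, so it is scalar; it is nonzero, whence \<open>B = A\<close> is real. As the
  indeterminates are linearly independent over \<open>\<real>\<close>, \<open>A h X = \<sigma>(h) X\<close> at \<open>h = 1\<close> gives
  \<open>A = \<sigma>(1) \<in> D(G)\<close>.
\<close>

section \<open>Invariant subspaces and commuting matrices\<close>

text \<open>Irreducibility is stated for record fields, while the matrices below live over
  type-class fields. This record passes from the second setting to the first.\<close>

definition type_ring :: "'k::field ring" where
  "type_ring = \<lparr>carrier = UNIV, mult = (*), one = 1, zero = 0, add = (+)\<rparr>"

lemma type_ring_sel:
  "carrier type_ring = UNIV" "x \<otimes>\<^bsub>type_ring\<^esub> y = x * y" "\<one>\<^bsub>type_ring\<^esub> = 1"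
  "\<zero>\<^bsub>type_ring\<^esub> = 0" "x \<oplus>\<^bsub>type_ring\<^esub> y = x + y"
  by (simp_all add: type_ring_def)

lemma field_type_ring: "field (type_ring :: 'k::field ring)"
proof -
  have "cring (type_ring :: 'k ring)"
  proof (rule cringI)
    show "abelian_group (type_ring :: 'k ring)"
      by (rule abelian_groupI)
        (auto simp: type_ring_sel algebra_simps intro: exI[of _ "- x" for x] left_minus)
    show "Group.comm_monoid (type_ring :: 'k ring)"
      by (rule comm_monoidI) (auto simp: type_ring_sel)
  qed (auto simp: type_ring_sel algebra_simps)
  then show ?thesis
    by (rule cring.cring_fieldI2) (auto simp: type_ring_sel intro: right_inverse)
qed

lemma finsum_type_ring:
  assumes "finite S"
  shows "(\<Oplus>\<^bsub>type_ring\<^esub>j\<in>S. f j) = (\<Sum>j\<in>S. (f j :: 'k::field))"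
proof -
  interpret field "type_ring :: 'k ring" by (rule field_type_ring)
  show ?thesis using assms
    by (induction S) (simp_all add: type_ring_sel)
qed

text \<open>Used twice: for \<open>of_real\<close> into the complex numbers, which supply
  eigenvalues, and for \<open>rat_const\<close> into the rational functions, where genericity
  lives.\<close>

locale real_field_hom =
  fixes \<kappa> :: "real \<Rightarrow> 'k::field"
  assumes hom_add: "\<kappa> (a + b) = \<kappa> a + \<kappa> b"
    and hom_mult: "\<kappa> (a * b) = \<kappa> a * \<kappa> b"
    and hom_one: "\<kappa> 1 = 1"
begin

lemma hom_zero: "\<kappa> 0 = 0"
  using hom_add[of 0 0] by (metis add_cancel_right_right)

lemma hom_sum: "\<kappa> (sum f S) = (\<Sum>i\<in>S. \<kappa> (f i))"
  by (induction S rule: infinite_finite_induct) (simp_all add: hom_zero hom_add)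

lemma hom_of_nat: "\<kappa> (of_nat n) = of_nat n"
  by (induction n) (simp_all add: hom_zero hom_add hom_one)

lemma hom_eq_0_iff: "\<kappa> a = 0 \<longleftrightarrow> a = 0"
proof
  assume "\<kappa> a = 0"
  then have "\<kappa> (a * inverse a) = 0" by (simp only: hom_mult) simp
  then show "a = 0" using hom_one by (cases "a = 0") simp_all
qed (simp add: hom_zero)

lemma hom_matrix_mult: "map_matrix \<kappa> (A ** B) = map_matrix \<kappa> A ** map_matrix \<kappa> B"
  by (simp add: matrix_matrix_mult_def map_matrix_def vec_eq_iff hom_sum hom_mult)

lemma hom_mat: "map_matrix \<kappa> (mat a) = mat (\<kappa> a)"
  by (simp add: mat_def map_matrix_def vec_eq_iff hom_zero)

lemma hom_ring_hom: "\<kappa> \<in> ring_hom real_ring type_ring"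
  by (auto simp: ring_hom_def real_ring_def type_ring_def hom_add hom_mult hom_one)

lemma irreducible_subspace:
  fixes D :: "'a \<Rightarrow> real^'n^'n" and U :: "('k^'n) set"
  assumes irr: "absolutely_irreducible G D"
    and U: "vec.subspace U"
    and inv: "\<And>g w. g \<in> carrier G \<Longrightarrow> w \<in> U \<Longrightarrow> map_matrix \<kappa> (D g) *v w \<in> U"
    and w: "w \<in> U" "w \<noteq> 0"
  shows "U = UNIV"
proof -
  interpret K: field "type_ring :: 'k ring" by (rule field_type_ring)
  interpret M: module type_ring "vec_space type_ring :: ('k, 'k^'n) module"
    by (rule module_vec_space[OF K.is_cring])
  have neg: "\<ominus>\<^bsub>vec_space type_ring\<^esub> a = - a" for a :: "'k^'n"
  proof (rule M.minus_equality)
    show "- a \<oplus>\<^bsub>vec_space type_ring\<^esub> a = \<zero>\<^bsub>vec_space type_ring\<^esub>"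
      by (simp add: vec_space_sel type_ring_sel vec_eq_iff)
  qed (simp_all add: vec_space_sel type_ring_sel)
  have add: "a \<oplus>\<^bsub>vec_space type_ring\<^esub> b = a + b" for a b :: "'k^'n"
    by (simp add: vec_space_sel type_ring_sel vec_eq_iff)
  have smult: "c \<odot>\<^bsub>vec_space type_ring\<^esub> a = c *s a" for c and a :: "'k^'n"
    by (simp add: vec_space_sel type_ring_sel vec_eq_iff)
  have zero: "\<zero>\<^bsub>vec_space type_ring\<^esub> = (0 :: 'k^'n)"
    by (simp add: vec_space_sel type_ring_sel vec_eq_iff)
  have "submodule U type_ring (vec_space type_ring)"
  proof (rule M.submoduleI)
    show "\<ominus>\<^bsub>vec_space type_ring\<^esub> a \<in> U" if "a \<in> U" for a
      using vec.subspace_neg[OF U that] by (simp add: neg)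
    show "\<zero>\<^bsub>vec_space type_ring\<^esub> \<in> U"
      using vec.subspace_0[OF U] unfolding zero .
    show "a \<oplus>\<^bsub>vec_space type_ring\<^esub> b \<in> U" if "a \<in> U" "b \<in> U" for a b
      using vec.subspace_add[OF U that] unfolding add .
    show "c \<odot>\<^bsub>vec_space type_ring\<^esub> a \<in> U" if "a \<in> U" for c a
      using vec.subspace_scale[OF U that] unfolding smult .
  qed (simp add: vec_space_sel type_ring_sel)
  moreover have "mat_act type_ring \<kappa> A w = map_matrix \<kappa> A *v w" for A :: "real^'n^'n" and w
    by (simp add: mat_act_def finsum_type_ring matrix_vector_mult_def map_matrix_def type_ring_sel)
  ultimately have "U = {0} \<or> U = carrier (vec_space type_ring)"
    using absolutely_irreducible_imp_irreducible_over[OF irr field_type_ring hom_ring_hom] inv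
    unfolding irreducible_over_def zero by auto
  then show ?thesis using w by (auto simp: vec_space_sel type_ring_sel)
qed

end

section \<open>Eigenvectors of complex matrices\<close>

lemma mat_mult_vec: "mat z *v x = z *s (x :: 'k::comm_semiring_1^'n)"
proof -
  have "(\<Sum>j\<in>UNIV. (if i = j then z else 0) * x $ j) = (\<Sum>j\<in>UNIV. if i = j then z * x $ j else 0)"
    for i
    by (intro sum.cong) simp_all
  then show ?thesis
    by (simp add: mat_def matrix_vector_mult_def vec_eq_iff)
qed

lemma complex_eigenvector_exists:
  fixes T :: "complex^'n^'n"
  obtains z x where "x \<noteq> 0" "T *v x = z *s x"
proof -
  define M where "M z = mat z - T" for z
  \<comment> \<open>The Leibniz expansion of the characteristic polynomial, with linear polynomials
    as entries, so that evaluation at \<open>z\<close> can be carried out factor by factor.\<close>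
  define p where "p = (\<Sum>\<pi> | \<pi> permutes (UNIV :: 'n set).
      [:of_int (sign \<pi>):] * (\<Prod>i\<in>UNIV. [:- T $ i $ \<pi> i, if i = \<pi> i then 1 else 0:]))"
  have p: "poly p z = det (M z)" for z
    unfolding p_def det_def M_def
    by (auto simp: poly_sum poly_prod mat_def intro!: sum.cong prod.cong)
  \<comment> \<open>Otherwise \<open>det (z - T)\<close> is a constant \<open>c\<close>, and \<open>det (1 - y T) = y\<^sup>n c\<close> for \<open>y \<noteq> 0\<close> contradicts
    continuity at \<open>0\<close>.\<close>
  have "\<exists>z. poly p z = 0"
  proof (rule ccontr)
    assume no_root: "\<nexists>z. poly p z = 0"
    then have "constant (poly p)" using fundamental_theorem_of_algebra by blast
    then obtain c where c: "\<And>z. det (M z) = c"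
      unfolding constant_def p by blast
    define q where "q y = det (\<chi> i j. (if i = j then 1 else 0) - y * T $ i $ j)" for y
    have q: "q y = y ^ CARD('n) * c" if "y \<noteq> 0" for y
    proof -
      have "q y = det (\<chi> i. y *s (M (1 / y) $ i))"
        unfolding q_def M_def mat_def using that
        by (intro arg_cong[of _ _ det]) (simp add: vec_eq_iff right_diff_distrib)
      also have "\<dots> = y ^ CARD('n) * det (M (1 / y))"
        by (subst det_rows_mul) (simp add: vec_lambda_eta)
      finally show ?thesis by (simp only: c)
    qed
    have "q 0 = 1"
      using det_I[where 'a = complex and 'n = 'n] by (simp add: q_def mat_def)
    moreover have "isCont q 0"
      unfolding q_def det_def by (simp only: vec_lambda_beta) (intro continuous_intros)
    ultimately have "(q \<longlongrightarrow> 1) (at 0)"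
      by (simp add: isCont_def)
    moreover have "(q \<longlongrightarrow> 0) (at 0)"
    proof (rule Lim_transform_eventually)
      have "((\<lambda>y. y ^ CARD('n) * c) \<longlongrightarrow> 0 ^ CARD('n) * c) (at 0)"
        by (intro tendsto_intros)
      moreover have "0 ^ CARD('n) * c = 0"
        by (simp add: zero_power)
      ultimately show "((\<lambda>y. y ^ CARD('n) * c) \<longlongrightarrow> 0) (at 0)"
        by (simp only:)
      show "\<forall>\<^sub>F y in at 0. y ^ CARD('n) * c = q y"
        by (auto simp: eventually_at_filter q)
    qed
    ultimately show False using tendsto_unique[of "at (0::complex)"] by force
  qed
  then obtain z where "det (M z) = 0" using p by auto
  then have "\<not> invertible (M z)" by (simp add: invertible_det_nz)
  then obtain x where x: "x \<noteq> 0" "M z *v x = 0"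
    using matrix_left_invertible_ker[of "M z"] invertible_left_inverse[of "M z"] by blast
  have "mat z *v x = z *s x" by (rule mat_mult_vec)
  then have "M z *v x = z *s x - T *v x"
    by (simp add: M_def matrix_vector_mult_diff_rdistrib)
  then show ?thesis using that[of x z] x by simp
qed

section \<open>Schur's lemma for absolutely irreducible representations\<close>

locale absolutely_irreducible_rep = group G for G (structure) +
  fixes D :: "'a \<Rightarrow> real^'n^'n"
  assumes finite_carrier: "finite (carrier G)"
    and hom: "D \<in> hom G GL"
    and irr: "absolutely_irreducible G D"
begin

lemma D_mult: "g \<in> carrier G \<Longrightarrow> h \<in> carrier G \<Longrightarrow> D (g \<otimes> h) = D g ** D h"
  using Group.hom_mult[OF hom] by (simp add: GL_def)

lemma D_invertible: "g \<in> carrier G \<Longrightarrow> invertible (D g)"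
  using hom by (auto simp: hom_def GL_def)

lemma D_one: "D \<one> = mat 1"
proof -
  have "D \<one> ** D \<one> = D \<one>"
    using D_mult[of \<one> \<one>] by simp
  then show ?thesis
    using D_invertible[of \<one>] by (metis invertible_def matrix_mul_assoc matrix_mul_rid one_closed)
qed

lemma D_inv: "g \<in> carrier G \<Longrightarrow> D g ** D (inv g) = mat 1" "g \<in> carrier G \<Longrightarrow> D (inv g) ** D g = mat 1"
  using D_mult[of g "inv g"] D_mult[of "inv g" g] by (simp_all add: D_one)

text \<open>Irreducibility over \<open>'k\<close> makes the orbit of every nonzero vector span. For
  \<open>w\<close> this takes the role that full dimensionality plays for the real point
  \<open>v\<close>.\<close>

lemma orbit_determines_matrix:
  fixes A B :: "'k::field^'n^'n"
  assumes "real_field_hom \<kappa>" and w: "w \<noteq> 0"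
    and eq: "\<And>g. g \<in> carrier G \<Longrightarrow>
      A *v (map_matrix \<kappa> (D g) *v w) = B *v (map_matrix \<kappa> (D g) *v w)"
  shows "A = B"
proof -
  interpret \<kappa>: real_field_hom \<kappa> by fact
  \<comment> \<open>Agreement is required on the whole orbit of \<open>y\<close>, which makes
    \<open>U\<close> invariant; the case \<open>g = \<one>\<close> recovers agreement at
    \<open>y\<close> itself.\<close>
  define U where "U = {y. \<forall>g\<in>carrier G.
      A *v (map_matrix \<kappa> (D g) *v y) = B *v (map_matrix \<kappa> (D g) *v y)}"
  have "U = UNIV"
  proof (rule \<kappa>.irreducible_subspace[OF irr _ _ _ w])
    show "vec.subspace U"
      unfolding vec.subspace_def U_def
      by (auto simp: matrix_vector_right_distrib matrix_vector_mult_scaleR vec.scale)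
    show "map_matrix \<kappa> (D g) *v y \<in> U" if "g \<in> carrier G" "y \<in> U" for g y
    proof -
      have "A *v (map_matrix \<kappa> (D (h \<otimes> g)) *v y) = B *v (map_matrix \<kappa> (D (h \<otimes> g)) *v y)"
        if "h \<in> carrier G" for h
        using that \<open>g \<in> carrier G\<close> \<open>y \<in> U\<close> by (simp add: U_def)
      then show ?thesis
        using that(1) by (simp add: U_def D_mult \<kappa>.hom_matrix_mult matrix_vector_mul_assoc matrix_mul_assoc)
    qed
    show "w \<in> U" using eq by (simp add: U_def)
  qed
  then have "y \<in> U" for y by simp
  then have "A *v y = B *v y" for y
    unfolding U_def using one_closed
    by (metis (mono_tags, lifting) D_one \<kappa>.hom_mat \<kappa>.hom_one matrix_vector_mul_lid mem_Collect_eq)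
  then show ?thesis by (simp add: matrix_eq)
qed

text \<open>Schur's lemma over the complex numbers: an eigenspace of the complexified
  \<open>T\<close> is invariant and nonzero, hence everything.\<close>

lemma commuting_real_matrix_scalar:
  assumes comm: "\<And>g. g \<in> carrier G \<Longrightarrow> D g ** T = T ** D g"
  obtains c where "T = mat c"
proof -
  interpret real_field_hom "of_real :: real \<Rightarrow> complex"
    by unfold_locales simp_all
  define T' where "T' = map_matrix complex_of_real T"
  obtain z x where x: "x \<noteq> 0" "T' *v x = z *s x"
    by (rule complex_eigenvector_exists)
  define U where "U = {y. T' *v y = z *s y}"
  have "U = UNIV"
  proof (rule irreducible_subspace[OF irr])
    show "vec.subspace U"
      unfolding vec.subspace_def U_def
      by (auto simp: matrix_vector_right_distrib vec.scale vec.scale_right_distrib)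
    show "map_matrix of_real (D g) *v y \<in> U" if "g \<in> carrier G" "y \<in> U" for g y
    proof -
      have "T' ** map_matrix of_real (D g) = map_matrix of_real (D g) ** T'"
        using comm[OF that(1)] by (simp add: T'_def hom_matrix_mult[symmetric])
      then have "T' *v (map_matrix of_real (D g) *v y) = map_matrix of_real (D g) *v (T' *v y)"
        by (simp add: matrix_vector_mul_assoc)
      then show ?thesis using that(2) by (simp add: U_def vec.scale)
    qed
    show "x \<in> U" "x \<noteq> 0" using x by (simp_all add: U_def)
  qed
  then have "T' *v y = mat z *v y" for y
    by (auto simp: U_def mat_mult_vec dest!: equalityD2)
  then have "T' = mat z" by (simp add: matrix_eq)
  then have T: "complex_of_real (T $ i $ j) = (if i = j then z else 0)" for i j
    by (simp add: T'_def map_matrix_def mat_def vec_eq_iff)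
  \<comment> \<open>The eigenvalue is a diagonal entry of a real matrix, so taking real parts loses
    nothing.\<close>
  have "T $ i $ j = (if i = j then Re z else 0)" for i j
    using T[of i j] by (metis Re_complex_of_real zero_complex.sel(1))
  then have "T = mat (Re z)"
    by (simp add: mat_def vec_eq_iff)
  then show ?thesis by (rule that)
qed

text \<open>
  Averaging the elementary matrix \<open>E\<^sub>i\<^sub>j\<close> over the group yields a real scalar matrix; the resulting
  orthogonality relations between matrix entries carry Schur's lemma over to \<open>K\<close>, which need
  not contain the eigenvalues of \<open>T\<close>.
\<close>

lemma commuting_matrix_scalar:
  fixes T :: "'k::field^'n^'n"
  assumes "real_field_hom \<kappa>"
    and comm: "\<And>g. g \<in> carrier G \<Longrightarrow> map_matrix \<kappa> (D g) ** T = T ** map_matrix \<kappa> (D g)"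
  obtains c where "T = mat c"
proof -
  interpret \<kappa>: real_field_hom \<kappa> by fact
  define P where "P i j = (\<chi> a b. \<Sum>g\<in>carrier G. D g $ a $ i * D (inv g) $ j $ b)" for i j
  have "\<exists>c. P i j = mat c" for i j
  proof -
    have "D h ** P i j = P i j ** D h" if h: "h \<in> carrier G" for h
    proof -
      have "(D h ** P i j) $ a $ b = (P i j ** D h) $ a $ b" for a b
      proof -
        have "(D h ** P i j) $ a $ b = (\<Sum>g\<in>carrier G. (\<Sum>k\<in>UNIV. D h $ a $ k * D g $ k $ i) * D (inv g) $ j $ b)"
          by (simp add: matrix_matrix_mult_def P_def sum_distrib_left sum_distrib_right mult.assoc)
            (rule sum.swap)
        also have "\<dots> = (\<Sum>g\<in>carrier G. D (h \<otimes> g) $ a $ i * D (inv g) $ j $ b)"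
          using h by (intro sum.cong) (simp_all add: D_mult matrix_matrix_mult_def)
        \<comment> \<open>Replacing \<open>g\<close> by \<open>inv h \<otimes> g\<close> turns
          \<open>inv g\<close> into \<open>inv g \<otimes> h\<close>.\<close>
        also have "\<dots> = (\<Sum>g\<in>carrier G. D g $ a $ i * D (inv g \<otimes> h) $ j $ b)"
          using h by (intro sum.reindex_bij_witness[of _ "\<lambda>g. inv h \<otimes> g" "\<lambda>g. h \<otimes> g"])
            (simp_all add: m_assoc[symmetric] inv_mult_group, simp add: m_assoc)
        also have "\<dots> = (\<Sum>g\<in>carrier G. D g $ a $ i * (\<Sum>k\<in>UNIV. D (inv g) $ j $ k * D h $ k $ b))"
          using h by (intro sum.cong) (simp_all add: D_mult matrix_matrix_mult_def)
        also have "\<dots> = (P i j ** D h) $ a $ b"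
          by (simp add: matrix_matrix_mult_def P_def sum_distrib_left sum_distrib_right mult.assoc)
            (rule sum.swap)
        finally show ?thesis .
      qed
      then show ?thesis by (simp add: vec_eq_iff)
    qed
    then show ?thesis using commuting_real_matrix_scalar by metis
  qed
  then obtain c where c: "\<And>i j. P i j = mat (c i j)" by metis
  define N where "N = (of_nat (card (carrier G)) :: 'k)"
  \<comment> \<open>The embedded reals force characteristic 0, so the group order may be divided
    out.\<close>
  have "N \<noteq> 0"
    using \<kappa>.hom_eq_0_iff[of "of_nat (card (carrier G))"] finite_carrier one_closed
    by (auto simp: N_def \<kappa>.hom_of_nat)
  \<comment> \<open>Summing \<open>T = D g T D (inv g)\<close> over the group and expanding
    \<open>T\<close> in elementary matrices leaves a combination of the scalar matrices
    \<open>P i j\<close>.\<close>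
  have NT: "N * T $ a $ b = (if a = b then (\<Sum>i\<in>UNIV. \<Sum>j\<in>UNIV. T $ i $ j * \<kappa> (c i j)) else 0)" for a b
  proof -
    have "T = map_matrix \<kappa> (D g) ** T ** map_matrix \<kappa> (D (inv g))" if "g \<in> carrier G" for g
      using comm[OF that] D_inv(1)[OF that]
      by (simp add: matrix_mul_assoc[symmetric] \<kappa>.hom_matrix_mult[symmetric] \<kappa>.hom_mat \<kappa>.hom_one)
    then have "N * T $ a $ b
        = (\<Sum>g\<in>carrier G. (map_matrix \<kappa> (D g) ** T ** map_matrix \<kappa> (D (inv g))) $ a $ b)"
      by (simp add: N_def)
    also have "\<dots> = (\<Sum>g\<in>carrier G. \<Sum>j\<in>UNIV. \<Sum>i\<in>UNIV. T $ i $ j * \<kappa> (D g $ a $ i * D (inv g) $ j $ b))"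
      by (simp add: matrix_matrix_mult_def sum_distrib_left sum_distrib_right \<kappa>.hom_mult mult_ac)
    also have "\<dots> = (\<Sum>j\<in>UNIV. \<Sum>g\<in>carrier G. \<Sum>i\<in>UNIV. T $ i $ j * \<kappa> (D g $ a $ i * D (inv g) $ j $ b))"
      by (rule sum.swap)
    also have "\<dots> = (\<Sum>j\<in>UNIV. \<Sum>i\<in>UNIV. \<Sum>g\<in>carrier G. T $ i $ j * \<kappa> (D g $ a $ i * D (inv g) $ j $ b))"
      by (intro sum.cong refl sum.swap)
    also have "\<dots> = (\<Sum>i\<in>UNIV. \<Sum>j\<in>UNIV. \<Sum>g\<in>carrier G. T $ i $ j * \<kappa> (D g $ a $ i * D (inv g) $ j $ b))"
      by (rule sum.swap)
    also have "\<dots> = (\<Sum>i\<in>UNIV. \<Sum>j\<in>UNIV. T $ i $ j * \<kappa> (P i j $ a $ b))"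
      by (simp add: P_def \<kappa>.hom_sum sum_distrib_left)
    also have "\<dots> = (if a = b then (\<Sum>i\<in>UNIV. \<Sum>j\<in>UNIV. T $ i $ j * \<kappa> (c i j)) else 0)"
      by (simp add: c mat_def \<kappa>.hom_zero)
    finally show ?thesis .
  qed
  have "T $ a $ b = (if a = b then (\<Sum>i\<in>UNIV. \<Sum>j\<in>UNIV. T $ i $ j * \<kappa> (c i j)) / N else 0)" for a b
  proof -
    have "T $ a $ b = N * T $ a $ b / N"
      using \<open>N \<noteq> 0\<close> by simp
    then show ?thesis unfolding NT by (cases "a = b") simp_all
  qed
  then have "T = mat ((\<Sum>i\<in>UNIV. \<Sum>j\<in>UNIV. T $ i $ j * \<kappa> (c i j)) / N)"
    by (simp add: mat_def vec_eq_iff)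
  then show ?thesis by (rule that)
qed

end

section \<open>Rigidity of linear symmetries\<close>

lemma mat_1_nonzero: "(mat 1 :: 'k::zero_neq_one^'n^'n) \<noteq> 0"
proof
  assume "(mat 1 :: 'k^'n^'n) = 0"
  then have "(mat 1 :: 'k^'n^'n) $ undefined $ undefined = 0" by (simp only: zero_index)
  then show False by (simp add: mat_def)
qed

lemma matrix_sum_mult: "(\<Sum>i\<in>S. A i) ** B = (\<Sum>i\<in>S. A i ** B)"
  for A :: "'i \<Rightarrow> 'k::comm_ring_1^'n^'m"
  by (induction S rule: infinite_finite_induct) 
    (simp_all add: matrix_matrix_mult_def vec_eq_iff distrib_right sum.distrib)

lemma matrix_mult_sum_right: "B ** (\<Sum>i\<in>S. A i) = (\<Sum>i\<in>S. B ** A i)"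
  for B :: "'k::comm_ring_1^'n^'m"
  by (induction S rule: infinite_finite_induct) (simp_all add: matrix_add_ldistrib)

lemma matrix_sum_vector_mult: "(\<Sum>i\<in>S. A i) *v x = (\<Sum>i\<in>S. A i *v x)"
  for x :: "'k::comm_ring_1^'n"
  by (induction S rule: infinite_finite_induct) (simp_all add: matrix_vector_mult_add_rdistrib)

section \<open>The group of linear symmetries\<close>

lemma finite_LinSym: "finite I \<Longrightarrow> finite (LinSym I v)"
  by (rule finite_subset[OF _ finite_permutations]) (auto simp: LinSym_def)

text \<open>With \<open>LinSym_inv\<close> this makes the linear symmetries a group, finite for
  finite \<open>I\<close>, so that one can average over them.\<close>

lemma LinSym_comp:
  assumes "\<sigma> \<in> LinSym I v" "\<tau> \<in> LinSym I v"
  shows "\<sigma> \<circ> \<tau> \<in> LinSym I v"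
proof -
  obtain A B where A: "invertible A" "\<forall>i\<in>I. A *v v i = v (\<sigma> i)"
    and B: "invertible B" "\<forall>i\<in>I. B *v v i = v (\<tau> i)"
    and p: "\<sigma> permutes I" "\<tau> permutes I"
    using assms by (auto simp: LinSym_def)
  have "invertible (A ** B) \<and> (\<forall>i\<in>I. (A ** B) *v v i = v ((\<sigma> \<circ> \<tau>) i))"
    using A B permutes_in_image[OF p(2)]
    by (auto simp: invertible_mult matrix_vector_mul_assoc[symmetric])
  then show ?thesis using permutes_compose[OF p(2,1)] by (auto simp: LinSym_def)
qed

lemma LinSym_inv:
  assumes "\<sigma> \<in> LinSym I v"
  shows "Hilbert_Choice.inv \<sigma> \<in> LinSym I v"
proof -
  obtain A where A: "invertible A" "\<And>i. i \<in> I \<Longrightarrow> A *v v i = v (\<sigma> i)" and p: "\<sigma> permutes I"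
    using assms by (auto simp: LinSym_def)
  obtain B where B: "A ** B = mat 1" "B ** A = mat 1"
    using A(1) by (auto simp: invertible_def)
  have "B *v v i = v (Hilbert_Choice.inv \<sigma> i)" if "i \<in> I" for i
  proof -
    have "Hilbert_Choice.inv \<sigma> i \<in> I"
      using that permutes_in_image[OF permutes_inv[OF p]] by simp
    from A(2)[OF this] have "A *v v (Hilbert_Choice.inv \<sigma> i) = v i"
      by (simp add: permutes_inverses(1)[OF p])
    then show ?thesis using B(2) by (metis matrix_vector_mul_assoc matrix_vector_mul_lid)
  qed
  moreover have "invertible B" using B by (auto simp: invertible_def)
  ultimately show ?thesis
    using permutes_inv[OF p] by (auto simp: LinSym_def)
qed

text \<open>A subspace is affine, so it contains the affine hull of the orbit. Hence a
  full-dimensional orbit spans linearly.\<close>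

lemma full_dimensional_orbit_subspace:
  assumes "full_dimensional_orbit H v" "subspace S" "\<And>h. h \<in> H \<Longrightarrow> h *v v \<in> S"
  shows "x \<in> S"
proof -
  have "affine hull ((\<lambda>h. h *v v) ` H) \<subseteq> S"
    using assms(2,3) by (intro hull_minimal subspace_imp_affine) auto
  then show ?thesis using assms(1) by (auto simp: full_dimensional_orbit_def)
qed

lemma full_dimensional_orbit_matrix_eq:
  assumes "full_dimensional_orbit H v" "\<And>h. h \<in> H \<Longrightarrow> A *v (h *v v) = B *v (h *v v)"
  shows "A = B"
proof -
  have "subspace {x. A *v x = B *v x}"
    by (auto simp: subspace_def matrix_vector_right_distrib matrix_vector_mult_scaleR)
  from full_dimensional_orbit_subspace[OF assms(1) this] assms(2)
  show ?thesis by (auto simp: matrix_eq)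
qed

lemma full_dimensional_orbit_nonzero:
  fixes v :: "real^'n"
  assumes "full_dimensional_orbit H v"
  shows "v \<noteq> 0"
proof
  assume "v = 0"
  \<comment> \<open>Index types are nonempty, so some coordinate vector exists and would have to be
    0.\<close>
  then have "axis undefined 1 \<in> {0 :: real^'n}"
    using full_dimensional_orbit_subspace[OF assms, of "{0}"] by simp
  then show False by (simp add: axis_eq_0_iff)
qed

context absolutely_irreducible_rep
begin

abbreviation "H \<equiv> D ` carrier G"

lemma one_in_image: "mat 1 \<in> H"
  using D_one by (metis imageI one_closed)

lemma mult_in_image: "g \<in> H \<Longrightarrow> h \<in> H \<Longrightarrow> g ** h \<in> H"
  by (auto simp: D_mult[symmetric])

text \<open>Left translations embed the image of \<open>G\<close> into the linear symmetries. They
  are extended by the identity off \<open>H\<close> because \<open>permutes\<close> demands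
  it.\<close>

lemma left_mult_permutes:
  assumes g: "g \<in> carrier G"
  shows "(\<lambda>h. if h \<in> H then D g ** h else h) permutes H"
proof (rule bij_imp_permutes)
  have "bij_betw (\<lambda>h. D g ** h) H H"
    using g by (intro bij_betw_byWitness[where f' = "\<lambda>h. D (inv g) ** h"])
      (auto simp: matrix_mul_assoc D_inv mult_in_image)
  then show "bij_betw (\<lambda>h. if h \<in> H then D g ** h else h) H H"
    by (simp cong: bij_betw_cong)
qed simp

text \<open>Stated for any \<open>x\<close> whose coordinates are linearly independent over the
  embedded reals, which is what \<open>indep\<close> expresses. The vector of indeterminates is the
  intended case.\<close>

lemma generic_symmetry_in_image:
  fixes x :: "'k::field^'n"
  assumes "real_field_hom \<kappa>"
    and indep: "\<And>E :: real^'n^'n. map_matrix \<kappa> E *v x = 0 \<Longrightarrow> E = 0"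
    and full: "full_dimensional_orbit H v"
    and LinSym_eq: "LinSym H (\<lambda>h. map_matrix \<kappa> h *v x) = LinSym H (\<lambda>h. h *v v)"
    and \<tau>: "\<tau> \<in> LinSym H (\<lambda>h. h *v v)"
    and A0: "\<And>h. h \<in> H \<Longrightarrow> A0 *v (h *v v) = \<tau> h *v v"
  shows "A0 = \<tau> (mat 1)"
proof -
  interpret \<kappa>: real_field_hom \<kappa> by fact
  let ?inv = "Hilbert_Choice.inv"
  define L where "L = LinSym H (\<lambda>h. h *v v)"
  have perm: "\<sigma> permutes H" if "\<sigma> \<in> L" for \<sigma>
    using that by (simp add: L_def LinSym_def)
  have invL: "?inv \<sigma> \<in> L" if "\<sigma> \<in> L" for \<sigma>
    using that LinSym_inv by (auto simp: L_def)
  have compL: "\<sigma> \<circ> \<rho> \<in> L" if "\<sigma> \<in> L" "\<rho> \<in> L" for \<sigma> \<rho>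
    using that LinSym_comp by (auto simp: L_def)
  have "\<forall>\<sigma>\<in>L. \<exists>A. \<forall>h\<in>H. A *v (h *v v) = \<sigma> h *v v"
    by (auto simp: L_def LinSym_def)
  then obtain A where A: "\<And>\<sigma> h. \<sigma> \<in> L \<Longrightarrow> h \<in> H \<Longrightarrow> A \<sigma> *v (h *v v) = \<sigma> h *v v"
    by metis
  \<comment> \<open>Genericity enters here: every symmetry of the orbit of \<open>v\<close> is also
    realised on the orbit of \<open>x\<close>.\<close>
  have "\<forall>\<sigma>\<in>L. \<exists>B. \<forall>h\<in>H. B *v (map_matrix \<kappa> h *v x) = map_matrix \<kappa> (\<sigma> h) *v x"
    unfolding L_def LinSym_eq[symmetric] by (auto simp: LinSym_def)
  then obtain B where B: "\<And>\<sigma> h. \<sigma> \<in> L \<Longrightarrow> h \<in> H \<Longrightarrow>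
      B \<sigma> *v (map_matrix \<kappa> h *v x) = map_matrix \<kappa> (\<sigma> h) *v x"
    by metis
  have x: "x \<noteq> 0" using indep[of "mat 1"] by (metis matrix_vector_mult_0_right mat_1_nonzero)
  \<comment> \<open>Uniqueness makes both assignments multiplicative. For \<open>A\<close> it comes
    from the spanning orbit of \<open>v\<close>, for \<open>B\<close> from irreducibility over
    \<open>'k\<close>.\<close>
  have A_unique: "M = A \<sigma>" if "\<sigma> \<in> L" "\<And>h. h \<in> H \<Longrightarrow> M *v (h *v v) = \<sigma> h *v v" for \<sigma> M
    using that A by (intro full_dimensional_orbit_matrix_eq[OF full]) simp
  have B_unique: "M = B \<sigma>"
    if "\<sigma> \<in> L" "\<And>h. h \<in> H \<Longrightarrow> M *v (map_matrix \<kappa> h *v x) = map_matrix \<kappa> (\<sigma> h) *v x" for \<sigma> M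
    using that B by (intro orbit_determines_matrix[OF \<kappa>.real_field_hom_axioms x]) simp
  have A_comp: "A \<sigma> ** A \<rho> = A (\<sigma> \<circ> \<rho>)" if "\<sigma> \<in> L" "\<rho> \<in> L" for \<sigma> \<rho>
    using that permutes_in_image[OF perm[OF that(2)]]
    by (intro A_unique compL) (simp_all add: matrix_vector_mul_assoc[symmetric] A)
  have B_comp: "B \<sigma> ** B \<rho> = B (\<sigma> \<circ> \<rho>)" if "\<sigma> \<in> L" "\<rho> \<in> L" for \<sigma> \<rho>
    using that permutes_in_image[OF perm[OF that(2)]]
    by (intro B_unique compL) (simp_all add: matrix_vector_mul_assoc[symmetric] B)
  \<comment> \<open>The averaged intertwiner obtained from the identity matrix.\<close>
  define T where "T = (\<Sum>\<sigma>\<in>L. map_matrix \<kappa> (A \<sigma>) ** B (?inv \<sigma>))"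
  have intertwine: "map_matrix \<kappa> (A \<rho>) ** T = T ** B \<rho>" if \<rho>: "\<rho> \<in> L" for \<rho>
  proof -
    have "map_matrix \<kappa> (A \<rho>) ** T = (\<Sum>\<sigma>\<in>L. map_matrix \<kappa> (A (\<rho> \<circ> \<sigma>)) ** B (?inv \<sigma>))"
      unfolding T_def using \<rho>
      by (simp add: matrix_mult_sum_right matrix_mul_assoc \<kappa>.hom_matrix_mult[symmetric] A_comp)
    \<comment> \<open>Substitute \<sigma> for \<rho> \<circ> \<sigma>; the inverse of the old index
      is then \<open>?inv \<sigma> \<circ> \<rho>\<close>.\<close>
    also have "\<dots> = (\<Sum>\<sigma>\<in>L. map_matrix \<kappa> (A \<sigma>) ** B (?inv \<sigma> \<circ> \<rho>))"
    proof (rule sum.reindex_bij_witness[of _ "\<lambda>\<sigma>. ?inv \<rho> \<circ> \<sigma>" "\<lambda>\<sigma>. \<rho> \<circ> \<sigma>"])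
      fix \<sigma> assume "\<sigma> \<in> L"
      note p = perm[OF \<rho>] perm[OF this]
      show "?inv \<rho> \<circ> (\<rho> \<circ> \<sigma>) = \<sigma>" "\<rho> \<circ> (?inv \<rho> \<circ> \<sigma>) = \<sigma>"
        using permutes_inv_o[OF p(1)] by (simp_all add: o_assoc)
      show "\<rho> \<circ> \<sigma> \<in> L" "?inv \<rho> \<circ> \<sigma> \<in> L"
        using \<open>\<sigma> \<in> L\<close> \<rho> invL compL by auto
      have "?inv (\<rho> \<circ> \<sigma>) \<circ> \<rho> = ?inv \<sigma>"
        using permutes_inv_o[OF p(1)] permutes_bij[OF p(1)] permutes_bij[OF p(2)]
        by (simp add: o_inv_distrib o_assoc[symmetric])
      then show "map_matrix \<kappa> (A (\<rho> \<circ> \<sigma>)) ** B (?inv (\<rho> \<circ> \<sigma>) \<circ> \<rho>)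
          = map_matrix \<kappa> (A (\<rho> \<circ> \<sigma>)) ** B (?inv \<sigma>)"
        by simp
    qed
    also have "\<dots> = T ** B \<rho>"
      unfolding T_def using \<rho>
      by (simp add: matrix_sum_mult matrix_mul_assoc[symmetric] B_comp invL)
    finally show ?thesis .
  qed
  have "map_matrix \<kappa> (D g) ** T = T ** map_matrix \<kappa> (D g)" if g: "g \<in> carrier G" for g
  proof -
    \<comment> \<open>On a left translation both representations take the value \<open>D g\<close>,
      so intertwining becomes commuting.\<close>
    define \<rho> where "\<rho> h = (if h \<in> H then D g ** h else h)" for h
    have \<rho>: "\<rho> \<in> L"
      using left_mult_permutes[OF g] D_invertible[OF g]
      by (auto simp: L_def LinSym_def \<rho>_def[abs_def] matrix_vector_mul_assoc)
    have "D g = A \<rho>"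
      using \<rho> by (intro A_unique) (simp_all add: \<rho>_def matrix_vector_mul_assoc)
    moreover have "map_matrix \<kappa> (D g) = B \<rho>"
      using \<rho> by (intro B_unique) (simp_all add: \<rho>_def matrix_vector_mul_assoc \<kappa>.hom_matrix_mult)
    ultimately show ?thesis using intertwine[OF \<rho>] by simp
  qed
  then obtain c where c: "T = mat c"
    using commuting_matrix_scalar[OF \<kappa>.real_field_hom_axioms] by metis
  define E where "E = (\<Sum>\<sigma>\<in>L. A \<sigma> ** ?inv \<sigma> (mat 1))"
  have inv_one: "?inv \<sigma> (mat 1) \<in> H" if "\<sigma> \<in> L" for \<sigma>
    using permutes_in_image[OF perm[OF invL[OF that]]] one_in_image by simp
  \<comment> \<open>On the vector \<open>x\<close> the intertwiner acts as a real matrix \<open>E\<close>, whose value at \<open>v\<close> shows \<open>T \<noteq> 0\<close>.\<close>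
  have "T *v x = (\<Sum>\<sigma>\<in>L. map_matrix \<kappa> (A \<sigma> ** ?inv \<sigma> (mat 1)) *v x)"
    unfolding T_def matrix_sum_vector_mult
  proof (intro sum.cong refl)
    fix \<sigma> assume "\<sigma> \<in> L"
    then have "B (?inv \<sigma>) *v x = map_matrix \<kappa> (?inv \<sigma> (mat 1)) *v x"
      using B[OF invL one_in_image] by (simp add: \<kappa>.hom_mat \<kappa>.hom_one)
    then show "(map_matrix \<kappa> (A \<sigma>) ** B (?inv \<sigma>)) *v x = map_matrix \<kappa> (A \<sigma> ** ?inv \<sigma> (mat 1)) *v x"
      by (simp add: matrix_vector_mul_assoc[symmetric] \<kappa>.hom_matrix_mult)
  qed
  also have "\<dots> = map_matrix \<kappa> E *v x"
  proof -
    have "map_matrix \<kappa> E = (\<Sum>\<sigma>\<in>L. map_matrix \<kappa> (A \<sigma> ** ?inv \<sigma> (mat 1)))"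
      by (simp add: E_def vec_eq_iff \<kappa>.hom_sum)
    then show ?thesis by (simp add: matrix_sum_vector_mult)
  qed
  finally have Tx: "T *v x = map_matrix \<kappa> E *v x" .
  \<comment> \<open>Each summand of \<open>E\<close> fixes \<open>v\<close>:
    \<open>?inv \<sigma> (mat 1)\<close> moves \<open>v\<close> to an orbit point that
    \<open>A \<sigma>\<close> sends back. Hence \<open>E\<close> multiplies \<open>v\<close> by the
    order of \<open>L\<close>.\<close>
  have "E *v v = (\<Sum>\<sigma>\<in>L. v)"
    unfolding E_def matrix_sum_vector_mult
  proof (intro sum.cong refl)
    fix \<sigma> assume "\<sigma> \<in> L"
    from A[OF this inv_one[OF this]] show "(A \<sigma> ** ?inv \<sigma> (mat 1)) *v v = v"
      by (simp add: matrix_vector_mul_assoc[symmetric] permutes_inverses(1)[OF perm[OF \<open>\<sigma> \<in> L\<close>]])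
  qed
  moreover have "card L \<noteq> 0"
    using \<tau> finite_LinSym[of H] finite_carrier by (auto simp: L_def card_eq_0_iff)
  ultimately have "E *v v \<noteq> 0"
    using full_dimensional_orbit_nonzero[OF full] by (simp add: sum_constant_scaleR del: sum_constant)
  then have "E \<noteq> 0" by auto
  then have "c \<noteq> 0"
    using indep[of E] Tx by (auto simp: c mat_mult_vec)
  have "\<tau> \<in> L" using \<tau> by (simp add: L_def)
  \<comment> \<open>Since \<open>T\<close> is the nonzero scalar \<open>c\<close>, cancelling it
    makes the matrices of \<tau> agree on \<open>x\<close>. Both sides are then real matrices
    applied to \<open>x\<close>, so \<open>indep\<close> applies to their difference.\<close>
  have "c *s (map_matrix \<kappa> (A \<tau>) *v x) = c *s (B \<tau> *v x)"
    using arg_cong[OF intertwine[OF \<open>\<tau> \<in> L\<close>], of "\<lambda>M. M *v x"]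
    by (simp add: c matrix_vector_mul_assoc[symmetric] mat_mult_vec vec.scale)
  then have "map_matrix \<kappa> (A \<tau>) *v x = map_matrix \<kappa> (\<tau> (mat 1)) *v x"
    using \<open>c \<noteq> 0\<close> B[OF \<open>\<tau> \<in> L\<close> one_in_image] by (simp add: \<kappa>.hom_mat \<kappa>.hom_one)
  moreover have "map_matrix \<kappa> (A \<tau> - \<tau> (mat 1)) = map_matrix \<kappa> (A \<tau>) - map_matrix \<kappa> (\<tau> (mat 1))"
    using \<kappa>.hom_add[of "a - b" b for a b] by (simp add: vec_eq_iff eq_diff_eq)
  ultimately have "A \<tau> - \<tau> (mat 1) = 0"
    by (intro indep) (simp add: matrix_vector_mult_diff_rdistrib)
  moreover have "A0 = A \<tau>"
    using A_unique[OF \<open>\<tau> \<in> L\<close>] A0 by blast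
  ultimately show ?thesis by simp
qed

end

section \<open>Linear independence of the indeterminates\<close>

lemma real_field_hom_rat_const: "real_field_hom rat_const"
  by unfold_locales
    (simp_all add: rat_const_def single_add mult_single One_fract_def)

text \<open>Entry \<open>i\<close> of the product is a linear form with denominator 1, and its
  coefficient at the \<open>k\<close>-th indeterminate is \<open>E $ i $ k\<close>.\<close>

lemma rat_X_independent:
  fixes E :: "real^'n::{finite,linorder}^'n::{finite,linorder}"
  assumes "map_matrix rat_const E *v rat_X = 0"
  shows "E = 0"
proof -
  define p where "p i = (\<Sum>j\<in>UNIV. Poly_Mapping.single (Poly_Mapping.single j (1::nat)) (E $ i $ j))" for i
  have Fract_sum: "(\<Sum>j\<in>S. Fract (f j) 1) = Fract (sum f S) (1 :: ('n \<Rightarrow>\<^sub>0 nat) \<Rightarrow>\<^sub>0 real)"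
    if "finite S" for f and S :: "'n set"
    using that by induction (simp_all add: Zero_fract_def)
  have "E $ i $ k = 0" for i k
  proof -
    have "(map_matrix rat_const E *v rat_X) $ i = Fract (p i) 1"
      by (simp add: matrix_vector_mult_def rat_const_def rat_X_def mult_single Fract_sum p_def)
    then have "p i = 0"
      using assms by (simp add: Zero_fract_def eq_fract)
    moreover have "Poly_Mapping.single j (1 :: nat) = Poly_Mapping.single k 1 \<longleftrightarrow> j = k" for j
      by (metis lookup_single_eq lookup_single_not_eq zero_neq_one)
    then have "Poly_Mapping.lookup (p i) (Poly_Mapping.single k 1) = E $ i $ k"
      by (simp add: p_def lookup_sum lookup_single when_def)
    ultimately show ?thesis by simp
  qed
  then show ?thesis by (simp add: vec_eq_iff)
qed

section \<open>Affine symmetries of the orbit polytope\<close>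

text \<open>A proper segment in \<open>P\<close> around \<open>s x\<close> pulls back to one around
  \<open>x\<close>, because \<open>s\<close> preserves ratios and is a bijection of
  \<open>P\<close>.\<close>

lemma affine_bij_extreme_point:
  assumes f: "linear f" and s: "\<And>x. x \<in> P \<Longrightarrow> s x = f x + c"
    and bij: "bij_betw s P P" and "convex P" and x: "x extreme_point_of P"
  shows "s x extreme_point_of P"
  unfolding extreme_point_of_def
proof (intro conjI ballI notI)
  have xP: "x \<in> P" using x by (simp add: extreme_point_of_def)
  then show "s x \<in> P" using bij by (auto simp: bij_betw_def)
  fix a' b' assume "a' \<in> P" "b' \<in> P" and mem: "s x \<in> open_segment a' b'"
  then obtain a b where ab: "a \<in> P" "b \<in> P" "a' = s a" "b' = s b"
    using bij by (metis bij_betw_imp_surj_on imageE)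
  obtain u where u: "0 < u" "u < 1" "s x = (1 - u) *\<^sub>R s a + u *\<^sub>R s b" "s a \<noteq> s b"
    using mem unfolding ab in_segment by auto
  \<comment> \<open>The point with the same parameter on the pulled-back segment. It has the image
    \<open>s x\<close>, so it equals \<open>x\<close> by injectivity of \<open>s\<close> on
    \<open>P\<close>.\<close>
  define y where "y = (1 - u) *\<^sub>R a + u *\<^sub>R b"
  have yP: "y \<in> P" using \<open>convex P\<close> ab u by (simp add: y_def convexD)
  have "s y = s x"
    using f unfolding u(3) s[OF yP] s[OF ab(1)] s[OF ab(2)]
    by (simp add: y_def linear_add linear_scale scaleR_right_distrib)
  then have "y = x" using bij yP xP by (auto simp: bij_betw_def inj_on_def)
  moreover have "y \<in> open_segment a b"
    using u unfolding in_segment y_def by auto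
  ultimately show False using x ab by (simp add: extreme_point_of_def)
qed

context absolutely_irreducible_rep
begin

lemma finite_orbit: "finite ((\<lambda>h. h *v v) ` H)"
  using finite_carrier by simp

lemma orbit_image:
  assumes g: "g \<in> carrier G"
  shows "(*v) (D g) ` (\<lambda>h. h *v v) ` H = (\<lambda>h. h *v v) ` H"
proof -
  have "bij_betw (\<lambda>h. D g ** h) H H"
    using permutes_imp_bij[OF left_mult_permutes[OF g]] by (simp cong: bij_betw_cong)
  then have "(\<lambda>h. h *v v) ` (\<lambda>h. D g ** h) ` H = (\<lambda>h. h *v v) ` H"
    by (simp only: bij_betw_imp_surj_on)
  then show ?thesis by (simp only: image_image matrix_vector_mul_assoc)
qed

lemma orbit_polytope_bij:
  assumes g: "g \<in> carrier G"
  shows "bij_betw ((*v) (D g)) (orbit_polytope H v) (orbit_polytope H v)"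
proof (rule bij_betw_imageI)
  show "inj_on ((*v) (D g)) (orbit_polytope H v)"
    using D_inv(2)[OF g] by (metis inj_onI matrix_vector_mul_assoc matrix_vector_mul_lid)
  show "(*v) (D g) ` orbit_polytope H v = orbit_polytope H v"
    using convex_hull_linear_image[OF matrix_vector_mul_linear, of "D g" "(\<lambda>h. h *v v) ` H"]
    by (simp only: orbit_polytope_def orbit_image[OF g])
qed

text \<open>Some orbit point is a vertex, and the group permutes the orbit points transitively.\<close>

lemma extreme_points_orbit_polytope:
  "{x. x extreme_point_of orbit_polytope H v} = (\<lambda>h. h *v v) ` H"
proof
  show "{x. x extreme_point_of orbit_polytope H v} \<subseteq> (\<lambda>h. h *v v) ` H"
    unfolding orbit_polytope_def by (rule extreme_points_of_convex_hull)
  have "{x. x extreme_point_of orbit_polytope H v} \<noteq> {}"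
    using Krein_Milman_polytope[OF finite_orbit[of v]] one_in_image
    by (force simp: orbit_polytope_def)
  then obtain x where x: "x extreme_point_of orbit_polytope H v" by blast
  then obtain k where k: "k \<in> carrier G" "x = D k *v v"
    using extreme_point_of_convex_hull unfolding orbit_polytope_def by blast
  show "(\<lambda>h. h *v v) ` H \<subseteq> {x. x extreme_point_of orbit_polytope H v}"
  proof clarsimp
    fix g assume g: "g \<in> carrier G"
    \<comment> \<open>This element carries the known vertex \<open>D k *v v\<close> to
      \<open>D g *v v\<close>.\<close>
    have "g \<otimes> inv k \<in> carrier G" using g k(1) by simp
    from orbit_polytope_bij[OF this, of v]
    have "D (g \<otimes> inv k) *v x extreme_point_of orbit_polytope H v"
      by (rule affine_bij_extreme_point[OF matrix_vector_mul_linear, where c = 0, rotated])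
        (use x in \<open>simp_all add: orbit_polytope_def\<close>)
    moreover have "D (g \<otimes> inv k) *v x = D g *v v"
      using g k by (simp add: D_mult matrix_vector_mul_assoc matrix_mul_assoc[symmetric] D_inv)
    ultimately show "D g *v v extreme_point_of orbit_polytope H v" by simp
  qed
qed

text \<open>The sum \<open>S\<close> of all group matrices absorbs right factors \<open>D g\<close>,
  so it is constant on the orbit and on its affine hull. That hull contains 0, where
  \<open>S\<close> vanishes.\<close>

lemma orbit_sum_eq_0:
  assumes "full_dimensional_orbit H v"
  shows "(\<Sum>h\<in>H. h *v v) = 0"
proof -
  define S where "S = (\<Sum>h\<in>H. h)"
  have "S ** D g = S" if g: "g \<in> carrier G" for g
  proof -
    have "bij_betw (\<lambda>h. h ** D g) H H"
      using g by (intro bij_betw_byWitness[where f' = "\<lambda>h. h ** D (inv g)"])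
        (auto simp: matrix_mul_assoc[symmetric] D_inv mult_in_image)
    then have "(\<Sum>h\<in>H. h ** D g) = (\<Sum>h\<in>H. h)"
      by (rule sum.reindex_bij_betw)
    then show ?thesis by (simp add: S_def matrix_sum_mult)
  qed
  then have "(\<lambda>h. h *v v) ` H \<subseteq> {x. S *v x = S *v v}"
    by (auto simp: matrix_vector_mul_assoc)
  moreover have "affine {x. S *v x = S *v v}"
    by (auto simp: affine_def matrix_vector_right_distrib matrix_vector_mult_scaleR
        scaleR_left_distrib[symmetric])
  ultimately have "affine hull ((\<lambda>h. h *v v) ` H) \<subseteq> {x. S *v x = S *v v}"
    by (rule hull_minimal)
  then have "0 \<in> {x. S *v x = S *v v}"
    using assms unfolding full_dimensional_orbit_def by blast
  then show ?thesis by (simp add: S_def matrix_sum_vector_mult)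
qed

text \<open>A symmetry permutes the vertices, which are exactly the orbit points. The trivial
  stabilizer identifies these with elements of \<open>H\<close>, so a permutation of points becomes
  one of \<open>H\<close>.\<close>

lemma affine_symmetry_linear:
  assumes full: "full_dimensional_orbit H v"
    and triv: "\<And>h. h \<in> H \<Longrightarrow> h *v v = v \<Longrightarrow> h = mat 1"
    and s: "s \<in> affine_symmetries (orbit_polytope H v)"
  obtains A \<sigma> where "invertible A" "\<And>x. x \<in> orbit_polytope H v \<Longrightarrow> s x = A *v x"
    "\<sigma> permutes H" "\<And>h. h \<in> H \<Longrightarrow> A *v (h *v v) = \<sigma> h *v v"
proof -
  define Orb where "Orb = (\<lambda>h. h *v v) ` H"
  let ?P = "orbit_polytope H v"
  obtain f c where f: "linear f" and sf: "\<And>x. x \<in> ?P \<Longrightarrow> s x = f x + c" and bij: "bij_betw s ?P ?P"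
    using s by (auto simp: affine_symmetries_def)
  have OP: "Orb \<subseteq> ?P" unfolding Orb_def orbit_polytope_def by (rule hull_subset)
  have inj_orb: "inj_on (\<lambda>h. h *v v) H"
  proof (rule inj_onI, clarsimp)
    fix g k assume gk: "g \<in> carrier G" "k \<in> carrier G" and eq: "D g *v v = D k *v v"
    have "D (inv k \<otimes> g) *v v = v"
      using gk D_inv(2)[OF gk(2)]
      by (simp add: D_mult matrix_vector_mul_assoc[symmetric] eq) (simp add: matrix_vector_mul_assoc)
    then have "D (inv k) ** D g = mat 1"
      using triv[of "D (inv k \<otimes> g)"] gk by (simp add: D_mult[symmetric])
    then show "D g = D k"
      using D_inv(1)[OF gk(2)] by (metis matrix_mul_assoc matrix_mul_lid matrix_mul_rid)
  qed
  have finO: "finite Orb" using finite_orbit by (simp add: Orb_def)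
  have Orb: "Orb = {x. x extreme_point_of ?P}"
    unfolding Orb_def extreme_points_orbit_polytope ..
  have "convex ?P" unfolding orbit_polytope_def by (rule convex_convex_hull)
  then have "s ` Orb \<subseteq> Orb"
    using affine_bij_extreme_point[OF f sf bij] unfolding Orb by blast
  moreover have injs: "inj_on s Orb"
    using bij OP by (auto simp: bij_betw_def intro: inj_on_subset)
  ultimately have sO: "bij_betw s Orb Orb"
    using endo_inj_surj[OF finO, of s] by (simp add: bij_betw_def)
  \<comment> \<open>Comparing the vertex sum before and after applying \<open>s\<close> isolates the
    translation part \<open>c\<close>.\<close>
  have "(\<Sum>y\<in>Orb. y) = 0"
    using orbit_sum_eq_0[OF full] by (simp add: Orb_def sum.reindex[OF inj_orb] o_def)
  moreover have "(\<Sum>y\<in>Orb. s y) = (\<Sum>y\<in>Orb. y)"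
    by (rule sum.reindex_bij_betw[OF sO])
  moreover have "(\<Sum>y\<in>Orb. s y) = (\<Sum>y\<in>Orb. f y + c)"
    using OP by (intro sum.cong) (auto simp: sf)
  moreover have "(\<Sum>y\<in>Orb. f y + c) = f (\<Sum>y\<in>Orb. y) + real (card Orb) *\<^sub>R c"
    by (simp add: sum.distrib linear_sum[OF f] sum_constant_scaleR del: sum_constant)
  ultimately have "real (card Orb) *\<^sub>R c = 0" using linear_0[OF f] by simp
  moreover have "card Orb \<noteq> 0"
    using finO one_in_image by (auto simp: Orb_def)
  ultimately have c: "c = 0" by simp
  define A where "A = matrix f"
  have sA: "s x = A *v x" if "x \<in> ?P" for x
    using sf[OF that] by (simp add: c A_def f)
  \<comment> \<open>The range of \<open>A\<close> contains the spanning orbit, so \<open>A\<close>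
    is surjective and therefore invertible.\<close>
  have "subspace (range ((*v) A))"
    by (intro linear_subspace_image matrix_vector_mul_linear subspace_UNIV)
  moreover have "h *v v \<in> range ((*v) A)" if "h \<in> H" for h
  proof -
    have "h *v v \<in> s ` Orb"
      using sO that by (auto simp: Orb_def bij_betw_def)
    then show ?thesis using sA OP by auto
  qed
  ultimately have "surj ((*v) A)"
    using full_dimensional_orbit_subspace[OF full] by blast
  then have "\<exists>B. A ** B = mat 1"
    by (simp only: matrix_right_invertible_surjective)
  then have "invertible A"
    by (simp add: invertible_right_inverse)
  define \<sigma> where "\<sigma> h = (if h \<in> H then inv_into H (\<lambda>h. h *v v) (s (h *v v)) else h)" for h
  have orb: "bij_betw (\<lambda>h. h *v v) H Orb"
    using inj_orb by (simp add: Orb_def bij_betw_def)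
  have "bij_betw (inv_into H (\<lambda>h. h *v v) \<circ> (s \<circ> (\<lambda>h. h *v v))) H H"
    using bij_betw_trans[OF bij_betw_trans[OF orb sO] bij_betw_inv_into[OF orb]] .
  then have "bij_betw \<sigma> H H"
    by (rule bij_betw_cong[THEN iffD1, rotated]) (simp add: \<sigma>_def)
  then have "\<sigma> permutes H"
    by (rule bij_imp_permutes) (simp add: \<sigma>_def)
  moreover have "A *v (h *v v) = \<sigma> h *v v" if "h \<in> H" for h
  proof -
    have hO: "h *v v \<in> Orb" using that by (simp add: Orb_def)
    then have "s (h *v v) \<in> Orb" using sO by (auto simp: bij_betw_def)
    then have "\<sigma> h *v v = s (h *v v)"
      using that f_inv_into_f[of "s (h *v v)" "\<lambda>h. h *v v" H] by (simp add: \<sigma>_def Orb_def)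
    then show ?thesis using sA OP hO by auto
  qed
  ultimately show ?thesis using that \<open>invertible A\<close> sA by blast
qed

text \<open>Evaluates the definite description in \<open>AGL\<close>: matrices that agree on the
  polytope agree on the spanning orbit.\<close>

lemma the_matrix_eq:
  assumes "full_dimensional_orbit H v" "invertible A"
    and s: "\<And>x. x \<in> orbit_polytope H v \<Longrightarrow> s x = A *v x"
  shows "(THE A. invertible A \<and> (\<forall>x\<in>orbit_polytope H v. s x = A *v x)) = A"
proof (rule the_equality)
  fix B assume B: "invertible B \<and> (\<forall>x\<in>orbit_polytope H v. s x = B *v x)"
  have "h *v v \<in> orbit_polytope H v" if "h \<in> H" for h
    using that unfolding orbit_polytope_def by (intro hull_inc) blast
  then show "B = A"
    using B s by (intro full_dimensional_orbit_matrix_eq[OF assms(1)]) metis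
qed (use assms in auto)

end

theorem theorem3:
  fixes G :: "('a, 'b) monoid_scheme"
    and D :: "'a \<Rightarrow> real^'n::{finite,linorder}^'n::{finite,linorder}"
    and v :: "real^'n::{finite,linorder}"
  assumes "group G" and "finite (carrier G)"
    and "D \<in> hom G GL"
    and "absolutely_irreducible G D"
    and "generic_point (D ` carrier G) v"
  shows "AGL (orbit_polytope (D ` carrier G) v) = D ` carrier G"
proof -
  interpret absolutely_irreducible_rep G D
    using assms by (simp add: absolutely_irreducible_rep_def absolutely_irreducible_rep_axioms_def)
  let ?P = "orbit_polytope H v"
  have full: "full_dimensional_orbit H v"
    and triv: "\<And>h. h \<in> H \<Longrightarrow> h *v v = v \<Longrightarrow> h = mat 1"
    and LinSym_eq: "LinSym H (\<lambda>h. map_matrix rat_const h *v rat_X) = LinSym H (\<lambda>h. h *v v)"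
    using assms(5) by (auto simp: generic_point_def)
  show ?thesis
  proof (intro subset_antisym subsetI)
    fix M assume "M \<in> AGL ?P"
    then obtain s where s: "s \<in> affine_symmetries ?P"
      and M: "M = (THE A. invertible A \<and> (\<forall>x\<in>?P. s x = A *v x))"
      by (auto simp: AGL_def)
    obtain A \<sigma> where A: "invertible A" "\<And>x. x \<in> ?P \<Longrightarrow> s x = A *v x"
      and \<sigma>: "\<sigma> permutes H" "\<And>h. h \<in> H \<Longrightarrow> A *v (h *v v) = \<sigma> h *v v"
      using affine_symmetry_linear[OF full triv s] by blast
    have "\<sigma> \<in> LinSym H (\<lambda>h. h *v v)"
      using A(1) \<sigma> by (auto simp: LinSym_def)
    then have "A = \<sigma> (mat 1)"
      using generic_symmetry_in_image[OF real_field_hom_rat_const rat_X_independent full LinSym_eq]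
        \<sigma>(2) by blast
    moreover have "M = A" unfolding M using the_matrix_eq[OF full] A by blast
    ultimately show "M \<in> H"
      using permutes_in_image[OF \<sigma>(1)] one_in_image by simp
  next
    fix M assume "M \<in> H"
    then obtain g where g: "g \<in> carrier G" "M = D g" by blast
    \<comment> \<open>Restricted to the polytope because \<open>affine_symmetries\<close> consists
      of extensional functions.\<close>
    define s where "s = restrict ((*v) M) ?P"
    have sM: "s x = M *v x" if "x \<in> ?P" for x
      using that by (simp add: s_def)
    have "bij_betw s ?P ?P"
      using bij_betw_cong[of ?P s "(*v) M" ?P] orbit_polytope_bij[OF g(1)] sM by (simp add: g(2))
    moreover have "\<exists>f c. linear f \<and> (\<forall>x\<in>?P. s x = f x + c)"
      using sM by (intro exI[of _ "(*v) M"] exI[of _ 0]) simp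
    ultimately have "s \<in> affine_symmetries ?P"
      by (simp add: affine_symmetries_def s_def)
    moreover have "(THE A. invertible A \<and> (\<forall>x\<in>?P. s x = A *v x)) = M"
      using D_invertible[OF g(1)] sM by (intro the_matrix_eq[OF full]) (simp_all add: g(2))
    ultimately show "M \<in> AGL ?P"
      unfolding AGL_def by force
  qed
qed

end
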